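(* If $\Phi\subseteq\Lambda_v$ is a set of values closed under $\equiv$ (i.e. $v\in\Phi$ and $v\equiv w$ with $w$ a value imply $w\in\Phi$), then $\Phi^{\bot\bot}\cap\Lambda_v=\Phi$.
   Context: Fix pairwise disjoint countably infinite sets of $\lambda$-variables ($x,y,\dots$), stack variables ($\alpha,\beta,\dots$), term variables ($a,b,\dots$), and countable sets of labels $l$ and constructors $C$. Values, terms, stacks, processes: $v,w::=x\mid\lambda x\,t\mid C[v]\mid\{l_i=v_i\}_{i\in I}$ (set $\Lambda_v$); $t,u::=a\mid v\mid t\,u\mid\mu\alpha\,t\mid p\mid v.l\mid\mathrm{case}_v[C_i[x_i]\to t_i]_{i\in I}\mid\delta_{v,w}$ (set $\Lambda$); $\pi::=\alpha\mid v.\pi\mid[t]\pi$ (set $\Pi$); $p::=t\ast\pi$; $I$ finite; $\lambda x$, $\mu\alpha$ and the $x_i$ in case branches are binders, term variables are never bound. Substitutions map $\lambda$-variables to values, stack variables to stacks, term variables to terms (capture-avoiding). $\succ$ is the smallest relation on processes with: $t\,u\ast\pi\succ u\ast[t]\pi$; $v\ast[t]\pi\succ t\ast v.\pi$; $\lambda x\,t\ast v.\pi\succ t[x:=v]\ast\pi$; $\mu\alpha\,t\ast\pi\succ t[\alpha:=\pi]\ast\pi$; $p\ast\pi\succ p$; $\{l_i=v_i\}_{i\in I}.l_k\ast\pi\succ v_k\ast\pi$ ($k\in I$); $\mathrm{case}_{C_k[v]}[C_i[x_i]\to t_i]_{i\in I}\ast\pi\succ t_k[x_k:=v]\ast\pi$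 ($k\in I$). A process is final if it is $v\ast\alpha$ with $v$ a value and $\alpha$ a stack variable; for a relation $R$, $p\Downarrow_R$ means $p\,R^*\,q$ with $q$ final. For $i\in\mathbb N$, inductively: $\rightsquigarrow_i=\succ\cup\{(\delta_{v,w}\ast\pi,v\ast\pi)\mid\exists j<i,\ v\not\equiv_jw\}$; $t\equiv_iu$ iff for all $j\le i$, stacks $\pi$, substitutions $\sigma$: $t\sigma\ast\pi\Downarrow_{\rightsquigarrow_j}\Leftrightarrow u\sigma\ast\pi\Downarrow_{\rightsquigarrow_j}$; $\not\equiv_i$ is its negation. $\rightsquigarrow=\bigcup_i\rightsquigarrow_i$, $\equiv=\bigcap_i\equiv_i$. Pole $\perp\!\!\!\perp=\{p\mid p\Downarrow_{\rightsquigarrow}\}$. For $\phi\subseteq\Lambda_v$: $\phi^\bot=\{\pi\in\Pi\mid\forall v\in\phi,\ v\ast\pi\in\perp\!\!\!\perp\}$ and $\phi^{\bot\bot}=\{t\in\Lambda\mid\forall\pi\in\phi^\bot,\ t\ast\pi\in\perp\!\!\!\perp\}$. *)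

theory Defs
  imports "HOL-Library.Finite_Map" "HOL-Library.Countable"
begin

text \<open>
  Expressions are taken up to renaming of bound variables, represented with de Bruijn indices.
  \<lambda>-variables and stack variables have two independent index spaces; \<open>Lam\<close> and every branch of
  \<open>Case\<close> bind \<lambda>-variable 0, and \<open>Mu\<close> binds stack variable 0. The indices that are not bound are
  the free variables. Term variables are never bound, hence are plain names.
  The families indexed by finite sets of labels or constructors are finite maps.
\<close>

datatype (dead 'l, dead 'c) val =
    Var nat
  | Lam "('l, 'c) trm"
  | Con 'c "('l, 'c) val"
  | Rcd "('l, ('l, 'c) val) fmap"
and ('l, 'c) trm =
    TVar nat
  | Val "('l, 'c) val"
  | App "('l, 'c) trm" "('l, 'c) trm"
  | Mu "('l, 'c) trm"
  | Prc "('l, 'c) proc"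
  | Proj "('l, 'c) val" 'l
  | Case "('l, 'c) val" "('c, ('l, 'c) trm) fmap"
  | Delta "('l, 'c) val" "('l, 'c) val"
and ('l, 'c) stk =
    SVar nat
  | Push "('l, 'c) val" "('l, 'c) stk"
  | Frame "('l, 'c) trm" "('l, 'c) stk"
and ('l, 'c) proc =
    Cmd "('l, 'c) trm" "('l, 'c) stk"  (infix "\<star>" 60)


subsection \<open>Renaming and capture-avoiding substitution\<close>

definition up :: "(nat \<Rightarrow> nat) \<Rightarrow> nat \<Rightarrow> nat" where
  "up r = case_nat 0 (\<lambda>n. Suc (r n))"

primrec ren_val :: "('l, 'c) val \<Rightarrow> (nat \<Rightarrow> nat) \<Rightarrow> (nat \<Rightarrow> nat) \<Rightarrow> ('l, 'c) val"
  and ren_trm :: "('l, 'c) trm \<Rightarrow> (nat \<Rightarrow> nat) \<Rightarrow> (nat \<Rightarrow> nat) \<Rightarrow> ('l, 'c) trm"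
  and ren_stk :: "('l, 'c) stk \<Rightarrow> (nat \<Rightarrow> nat) \<Rightarrow> (nat \<Rightarrow> nat) \<Rightarrow> ('l, 'c) stk"
  and ren_proc :: "('l, 'c) proc \<Rightarrow> (nat \<Rightarrow> nat) \<Rightarrow> (nat \<Rightarrow> nat) \<Rightarrow> ('l, 'c) proc" where
  "ren_val (Var x) r s = Var (r x)"
| "ren_val (Lam t) r s = Lam (ren_trm t (up r) s)"
| "ren_val (Con c v) r s = Con c (ren_val v r s)"
| "ren_val (Rcd m) r s = Rcd (fmmap (\<lambda>v. ren_val v r s) m)"
| "ren_trm (TVar a) r s = TVar a"
| "ren_trm (Val v) r s = Val (ren_val v r s)"
| "ren_trm (App t u) r s = App (ren_trm t r s) (ren_trm u r s)"
| "ren_trm (Mu t) r s = Mu (ren_trm t r (up s))"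
| "ren_trm (Prc p) r s = Prc (ren_proc p r s)"
| "ren_trm (Proj v l) r s = Proj (ren_val v r s) l"
| "ren_trm (Case v b) r s = Case (ren_val v r s) (fmmap (\<lambda>t. ren_trm t (up r) s) b)"
| "ren_trm (Delta v w) r s = Delta (ren_val v r s) (ren_val w r s)"
| "ren_stk (SVar k) r s = SVar (s k)"
| "ren_stk (Push v \<pi>) r s = Push (ren_val v r s) (ren_stk \<pi> r s)"
| "ren_stk (Frame t \<pi>) r s = Frame (ren_trm t r s) (ren_stk \<pi> r s)"
| "ren_proc (t \<star> \<pi>) r s = ren_trm t r s \<star> ren_stk \<pi> r s"

text \<open>A substitution gives the images of the \<lambda>-variables, the stack variables and the term
  variables, in this order.\<close>

type_synonym ('l, 'c) subst =
  "(nat \<Rightarrow> ('l, 'c) val) \<times> (nat \<Rightarrow> ('l, 'c) stk) \<times> (nat \<Rightarrow> ('l, 'c) trm)"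

text \<open>\<open>up_lam\<close> and \<open>up_mu\<close> carry a substitution under a \<lambda>-variable binder and under a
  stack variable binder, respectively.\<close>

fun up_lam :: "('l, 'c) subst \<Rightarrow> ('l, 'c) subst" where
  "up_lam (f, g, h) =
    (case_nat (Var 0) (\<lambda>x. ren_val (f x) Suc id),
     \<lambda>k. ren_stk (g k) Suc id,
     \<lambda>a. ren_trm (h a) Suc id)"

fun up_mu :: "('l, 'c) subst \<Rightarrow> ('l, 'c) subst" where
  "up_mu (f, g, h) =
    (\<lambda>x. ren_val (f x) id Suc,
     case_nat (SVar 0) (\<lambda>k. ren_stk (g k) id Suc),
     \<lambda>a. ren_trm (h a) id Suc)"

primrec subst_val :: "('l, 'c) val \<Rightarrow> ('l, 'c) subst \<Rightarrow> ('l, 'c) val"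
  and subst_trm :: "('l, 'c) trm \<Rightarrow> ('l, 'c) subst \<Rightarrow> ('l, 'c) trm"
  and subst_stk :: "('l, 'c) stk \<Rightarrow> ('l, 'c) subst \<Rightarrow> ('l, 'c) stk"
  and subst_proc :: "('l, 'c) proc \<Rightarrow> ('l, 'c) subst \<Rightarrow> ('l, 'c) proc" where
  "subst_val (Var x) \<sigma> = fst \<sigma> x"
| "subst_val (Lam t) \<sigma> = Lam (subst_trm t (up_lam \<sigma>))"
| "subst_val (Con c v) \<sigma> = Con c (subst_val v \<sigma>)"
| "subst_val (Rcd m) \<sigma> = Rcd (fmmap (\<lambda>v. subst_val v \<sigma>) m)"
| "subst_trm (TVar a) \<sigma> = snd (snd \<sigma>) a"
| "subst_trm (Val v) \<sigma> = Val (subst_val v \<sigma>)"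
| "subst_trm (App t u) \<sigma> = App (subst_trm t \<sigma>) (subst_trm u \<sigma>)"
| "subst_trm (Mu t) \<sigma> = Mu (subst_trm t (up_mu \<sigma>))"
| "subst_trm (Prc p) \<sigma> = Prc (subst_proc p \<sigma>)"
| "subst_trm (Proj v l) \<sigma> = Proj (subst_val v \<sigma>) l"
| "subst_trm (Case v b) \<sigma> = Case (subst_val v \<sigma>) (fmmap (\<lambda>t. subst_trm t (up_lam \<sigma>)) b)"
| "subst_trm (Delta v w) \<sigma> = Delta (subst_val v \<sigma>) (subst_val w \<sigma>)"
| "subst_stk (SVar k) \<sigma> = fst (snd \<sigma>) k"
| "subst_stk (Push v \<pi>) \<sigma> = Push (subst_val v \<sigma>) (subst_stk \<pi> \<sigma>)"
| "subst_stk (Frame t \<pi>) \<sigma> = Frame (subst_trm t \<sigma>) (subst_stk \<pi> \<sigma>)"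
| "subst_proc (t \<star> \<pi>) \<sigma> = subst_trm t \<sigma> \<star> subst_stk \<pi> \<sigma>"

text \<open>Replacement of the variable bound by an enclosing binder that is being removed: the
  remaining free indices are decremented.\<close>

definition inst_lam :: "('l, 'c) trm \<Rightarrow> ('l, 'c) val \<Rightarrow> ('l, 'c) trm" where
  "inst_lam t v = subst_trm t (case_nat v Var, SVar, TVar)"

definition inst_mu :: "('l, 'c) trm \<Rightarrow> ('l, 'c) stk \<Rightarrow> ('l, 'c) trm" where
  "inst_mu t \<pi> = subst_trm t (Var, case_nat \<pi> SVar, TVar)"


subsection \<open>Reduction and equivalence\<close>

inductive_set red :: "(('l, 'c) proc \<times> ('l, 'c) proc) set" where
  "(App t u \<star> \<pi>, u \<star> Frame t \<pi>) \<in> red"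
| "(Val v \<star> Frame t \<pi>, t \<star> Push v \<pi>) \<in> red"
| "(Val (Lam t) \<star> Push v \<pi>, inst_lam t v \<star> \<pi>) \<in> red"
| "(Mu t \<star> \<pi>, inst_mu t \<pi> \<star> \<pi>) \<in> red"
| "(Prc p \<star> \<pi>, p) \<in> red"
| "fmlookup m l = Some v \<Longrightarrow> (Proj (Rcd m) l \<star> \<pi>, Val v \<star> \<pi>) \<in> red"
| "fmlookup b c = Some t \<Longrightarrow> (Case (Con c v) b \<star> \<pi>, inst_lam t v \<star> \<pi>) \<in> red"

definition final :: "('l, 'c) proc \<Rightarrow> bool" where
  "final p \<longleftrightarrow> (\<exists>v k. p = Val v \<star> SVar k)"

definition converges :: "(('l, 'c) proc \<times> ('l, 'c) proc) set \<Rightarrow> ('l, 'c) proc \<Rightarrow> bool" where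
  "converges R p \<longleftrightarrow> (\<exists>q. (p, q) \<in> R\<^sup>* \<and> final q)"

context
  notes conj_cong [fundef_cong]
begin

function red_at :: "nat \<Rightarrow> (('l, 'c) proc \<times> ('l, 'c) proc) set"
  and equiv_at :: "nat \<Rightarrow> ('l, 'c) trm \<Rightarrow> ('l, 'c) trm \<Rightarrow> bool" where
  "red_at i =
    red \<union> {(Delta v w \<star> \<pi>, Val v \<star> \<pi>) | v w \<pi>. \<exists>j<i. \<not> equiv_at j (Val v) (Val w)}"
| "equiv_at i t u \<longleftrightarrow>
    (\<forall>j\<le>i. \<forall>\<pi> \<sigma>. converges (red_at j) (subst_trm t \<sigma> \<star> \<pi>) \<longleftrightarrow>
                  converges (red_at j) (subst_trm u \<sigma> \<star> \<pi>))"
  by pat_completeness auto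
termination
  by (relation "measure (case_sum (\<lambda>i. 2 * i) (\<lambda>(i, t, u). 2 * i + 1))") auto

end

declare red_at.simps [simp del] equiv_at.simps [simp del]

definition red_inf :: "(('l, 'c) proc \<times> ('l, 'c) proc) set" where
  "red_inf = (\<Union>i. red_at i)"

definition equiv_inf :: "('l, 'c) trm \<Rightarrow> ('l, 'c) trm \<Rightarrow> bool" where
  "equiv_inf t u \<longleftrightarrow> (\<forall>i. equiv_at i t u)"


subsection \<open>Orthogonality\<close>

definition pole :: "('l, 'c) proc set" where
  "pole = {p. converges red_inf p}"

definition orth :: "('l, 'c) val set \<Rightarrow> ('l, 'c) stk set" where
  "orth \<Phi> = {\<pi>. \<forall>v\<in>\<Phi>. Val v \<star> \<pi> \<in> pole}"

definition biorth :: "('l, 'c) val set \<Rightarrow> ('l, 'c) trm set" where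
  "biorth \<Phi> = {t. \<forall>\<pi>\<in>orth \<Phi>. t \<star> \<pi> \<in> pole}"

end

theory Submission imports Defs begin

text \<open>
  A value \<open>v\<close> of \<open>biorth \<Phi>\<close> outside \<open>\<Phi>\<close> is inequivalent to every \<open>w \<in> \<Phi>\<close>. The stack
  \<open>[\<lambda>x \<delta>\<^bsub>x,v\<^esub>]\<alpha>\<close> separates it from \<open>\<Phi>\<close>: started with \<open>w\<close> it leads to \<open>\<delta>\<^bsub>w,v\<^esub> \<star> \<alpha>\<close>, hence to the
  final process \<open>w \<star> \<alpha>\<close>, so that it is orthogonal to \<open>\<Phi>\<close>; started with \<open>v\<close> it can only
  lead to \<open>\<delta>\<^bsub>v,v\<^esub> \<star> \<alpha>\<close>, which is stuck because equivalence is reflexive.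
\<close>

text \<open>The maps are left general because each binder changes them: \<open>up r\<close> with
  \<open>up_lam\<close>, or \<open>up s\<close> with \<open>up_mu\<close>, satisfy the hypotheses
  again.\<close>

lemma subst_ren_inverse:
  fixes v :: "('l, 'c) val" and t :: "('l, 'c) trm"
    and \<pi> :: "('l, 'c) stk" and p :: "('l, 'c) proc"
  shows "(\<And>x. f (r x) = Var x) \<Longrightarrow> (\<And>k. g (s k) = SVar k) \<Longrightarrow>
      subst_val (ren_val v r s) (f, g, TVar) = v"
    and "(\<And>x. f (r x) = Var x) \<Longrightarrow> (\<And>k. g (s k) = SVar k) \<Longrightarrow>
      subst_trm (ren_trm t r s) (f, g, TVar) = t"
    and "(\<And>x. f (r x) = Var x) \<Longrightarrow> (\<And>k. g (s k) = SVar k) \<Longrightarrow>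
      subst_stk (ren_stk \<pi> r s) (f, g, TVar) = \<pi>"
    and "(\<And>x. f (r x) = Var x) \<Longrightarrow> (\<And>k. g (s k) = SVar k) \<Longrightarrow>
      subst_proc (ren_proc p r s) (f, g, TVar) = p"
proof (induction v and t and \<pi> and p arbitrary: f g r s and f g r s and f g r s and f g r s)
  case (Lam t)
  show ?case
    by (simp, rule Lam.IH) (auto simp: Lam.prems up_def split: nat.split)
next
  case (Rcd m)
  have "subst_val (ren_val v r s) (f, g, TVar) = v" if "v \<in> fmran' m" for v
    by (rule Rcd.IH[OF that]) (auto simp: Rcd.prems)
  then show ?case
    by (simp add: fmap.map_comp o_def fmap.map_ident_strong)
next
  case (Mu t)
  show ?case
    by (simp, rule Mu.IH) (auto simp: Mu.prems up_def split: nat.split)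
next
  case (Case v b)
  have "subst_trm (ren_trm t (up r) s) (up_lam (f, g, TVar)) = t" if "t \<in> fmran' b" for t
    by (simp, rule Case.IH(2)[OF that]) (auto simp: Case.prems up_def split: nat.split)
  moreover have "subst_val (ren_val v r s) (f, g, TVar) = v"
    by (rule Case.IH(1)) (auto simp: Case.prems)
  ultimately show ?case
    by (simp add: fmap.map_comp o_def fmap.map_ident_strong del: up_lam.simps)
qed simp_all

text \<open>A level \<open>j\<close> separating \<open>v\<close> from \<open>w\<close> enables the
  delta step at all levels above \<open>j\<close>, for instance at \<open>Suc j\<close>.\<close>

lemma red_inf_iff:
  "(p, q) \<in> red_inf \<longleftrightarrow>
    (p, q) \<in> red \<or> (\<exists>v w \<pi>. p = Delta v w \<star> \<pi> \<and> q = Val v \<star> \<pi> \<and> \<not> equiv_inf (Val v) (Val w))"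
  unfolding red_inf_def equiv_inf_def by (auto simp: red_at.simps)

lemma equiv_inf_refl: "equiv_inf t t"
  by (simp add: equiv_inf_def equiv_at.simps)

lemma converges_step: "(p, q) \<in> R \<Longrightarrow> converges R q \<Longrightarrow> converges R p"
  unfolding converges_def by (meson converse_rtrancl_into_rtrancl)

text \<open>As \<open>p\<close> is not final, a reduction to a final process has a first step, which
  must lead to \<open>q\<close>.\<close>

lemma converges_deterministic_step:
  assumes "\<And>q'. (p, q') \<in> R \<longleftrightarrow> q' = q" and "\<not> final p"
  shows "converges R p \<longleftrightarrow> converges R q"
  using assms by (metis converges_def converges_step converse_rtranclE)

text \<open>The shift by \<open>Suc\<close> keeps the free variables of \<open>v\<close> from being
  captured by the lambda; \<open>SVar 0\<close> is an arbitrary choice.\<close>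

definition delta_stk :: "('l, 'c) val \<Rightarrow> ('l, 'c) stk" where
  "delta_stk v = Frame (Val (Lam (Delta (Var 0) (ren_val v Suc id)))) (SVar 0)"

lemma converges_delta_stk:
  "converges red_inf (Val w \<star> delta_stk v) \<longleftrightarrow> converges red_inf (Delta w v \<star> SVar 0)"
proof -
  let ?t = "Delta (Var 0) (ren_val v Suc id)"
  have "(Val w \<star> delta_stk v, q) \<in> red_inf \<longleftrightarrow> q = Val (Lam ?t) \<star> Push w (SVar 0)" for q
    by (auto simp: red_inf_iff delta_stk_def elim: red.cases intro: red.intros)
  then have 1: "converges red_inf (Val w \<star> delta_stk v) \<longleftrightarrow>
      converges red_inf (Val (Lam ?t) \<star> Push w (SVar 0))"
    by (rule converges_deterministic_step) (simp add: final_def delta_stk_def)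
  \<comment> \<open>Instantiating the bound variable cancels the shift of \<open>v\<close>.\<close>
  have inst: "inst_lam ?t w = Delta w v"
    by (simp add: inst_lam_def subst_ren_inverse(1))
  have "(Val (Lam ?t) \<star> Push w (SVar 0), q) \<in> red_inf \<longleftrightarrow> q = inst_lam ?t w \<star> SVar 0" for q
    by (auto simp: red_inf_iff elim: red.cases intro: red.intros)
  then have "converges red_inf (Val (Lam ?t) \<star> Push w (SVar 0)) \<longleftrightarrow>
      converges red_inf (inst_lam ?t w \<star> SVar 0)"
    by (rule converges_deterministic_step) (simp add: final_def)
  with 1 inst show ?thesis
    by simp
qed

lemma converges_Delta_iff:
  "converges red_inf (Delta w v \<star> SVar k) \<longleftrightarrow> \<not> equiv_inf (Val w) (Val v)"
proof
  assume "converges red_inf (Delta w v \<star> SVar k)"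
  \<comment> \<open>The process is not final, so it must reduce, and only the delta rule can
    apply.\<close>
  then obtain q where "(Delta w v \<star> SVar k, q) \<in> red_inf"
    unfolding converges_def by (auto simp: final_def elim: converse_rtranclE)
  then show "\<not> equiv_inf (Val w) (Val v)"
    by (auto simp: red_inf_iff elim: red.cases)
next
  assume "\<not> equiv_inf (Val w) (Val v)"
  then have "(Delta w v \<star> SVar k, Val w \<star> SVar k) \<in> red_inf"
    by (simp add: red_inf_iff)
  moreover have "converges red_inf (Val w \<star> SVar k)"
    by (auto simp: converges_def final_def)
  ultimately show "converges red_inf (Delta w v \<star> SVar k)"
    by (rule converges_step)
qed

lemma delta_stk_pole_iff: "Val w \<star> delta_stk v \<in> pole \<longleftrightarrow> \<not> equiv_inf (Val w) (Val v)"
  by (simp add: pole_def converges_delta_stk converges_Delta_iff)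

theorem theorem4:
  fixes \<Phi> :: "('l::countable, 'c::countable) val set"
  assumes "\<And>v w. v \<in> \<Phi> \<Longrightarrow> equiv_inf (Val v) (Val w) \<Longrightarrow> w \<in> \<Phi>"
  shows "biorth \<Phi> \<inter> range Val = Val ` \<Phi>"
proof
  show "Val ` \<Phi> \<subseteq> biorth \<Phi> \<inter> range Val"
    by (auto simp: biorth_def orth_def)
  show "biorth \<Phi> \<inter> range Val \<subseteq> Val ` \<Phi>"
  proof clarify
    fix v assume "Val v \<in> biorth \<Phi>"
    \<comment> \<open>Otherwise \<open>Val v \<star> delta_stk v\<close> would be in the pole,
      against reflexivity.\<close>
    then have "delta_stk v \<notin> orth \<Phi>"
      using delta_stk_pole_iff equiv_inf_refl by (auto simp: biorth_def)
    then obtain w where "w \<in> \<Phi>" "equiv_inf (Val w) (Val v)"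
      by (auto simp: orth_def delta_stk_pole_iff)
    then show "Val v \<in> Val ` \<Phi>"
      using assms by blast
  qed
qed

end
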